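(* Let $k\in\{1,2\}$. Given any $f_k\in D_{kk}$, there exists a unique multiplier $\lambda^{kk}=(\lambda^{kk}_0,\lambda^{kk}_1,\lambda^{kk}_2)\in\mathbb{R}\times\mathbb{R}^3\times\mathbb{R}$ such that the function $$M_{kk}(v)=\exp\left(m_k\lambda^{kk}_0+m_k\lambda^{kk}_1\cdot v+m_k\lambda^{kk}_2|v|^2\right)$$ solves the minimization problem $$\min_{g\in\chi_k}\int_{\mathbb{R}^3}\nu_{kk}\,h(g)\,dv .$$
   Context: Here $m_k>0$ is a particle mass and $h(z)=z\ln z-z$ for $z>0$, $h(0)=0$. For $\lambda=(\lambda_0,\lambda_1,\lambda_2)\in\mathbb{R}\times\mathbb{R}^3\times\mathbb{R}=\mathbb{R}^5$ let $\exp^k_\lambda(v)=\exp(\lambda\cdot a^k(v))$ with $a^k(v)=(m_k,\,m_kv,\,m_k|v|^2)^T\in\mathbb{R}^5$. Let $\nu_{kk}$ be a measurable function of $v\in\mathbb{R}^3$ (the collision frequency) and $$D_{kk}=\{g\ge 0\mid \nu_{kk}(1+|v|^2)g\in L^1(\mathbb{R}^3),\ g\not\equiv 0\}$$ (with $g\not\equiv0$ understood up to null sets). Standing assumption on the collision frequency: $\nu_{kk}$ is strictly positive and $$\{\lambda\in\mathbb{R}^5\mid \exp^k_\lambda\in D_{kk}\}=\{\lambda\in\mathbb{R}^5\mid\exp^k_\lambda\in L^1(\mathbb{R}^3)\}=\{\lambda\in\mathbb{R}^5\mid\lambda_2<0\}.$$ The admissible set is $$\chi_k=\left\{g\ \Big|\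 g\ge 0,\ \nu_{kk}(1+|v|^2)g\in L^1(\mathbb{R}^3),\ \int_{\mathbb{R}^3}\nu_{kk}\,a^k(v)\,(g-f_k)\,dv=0\right\}.$$ "$M_{kk}$ solves the problem" means $M_{kk}\in\chi_k$ and $M_{kk}$ attains the minimum; the objective is an extended-real-valued integral (the value $+\infty$ is allowed). *)

theory Defs
  imports "HOL-Analysis.Analysis"
begin

type_synonym velocity = "real ^ 3"

text \<open>
  The type of multipliers and of moment vectors; its library inner product
  is the Euclidean one, i.e. it is a copy of Euclidean 5-space.
\<close>
type_synonym moments = "real \<times> (real ^ 3) \<times> real"

definition h :: "real \<Rightarrow> real" where
  "h z = (if z = 0 then 0 else z * ln z - z)"

definition moment_vec :: "real \<Rightarrow> velocity \<Rightarrow> moments" where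
  "moment_vec m v = (m, m *\<^sub>R v, m * (norm v)\<^sup>2)"

definition exp_mult :: "real \<Rightarrow> moments \<Rightarrow> velocity \<Rightarrow> real" where
  "exp_mult m l v = exp (l \<bullet> moment_vec m v)"

text \<open>
  The conditions on \<open>g\<close> below are understood up to Lebesgue null sets, as for elements
  of \<open>L\<^sup>1\<close>. Values of \<open>h\<close> at negative arguments therefore never matter.
\<close>
definition D_set :: "(velocity \<Rightarrow> real) \<Rightarrow> (velocity \<Rightarrow> real) set" where
  "D_set \<nu> = {g. (AE v in lebesgue. 0 \<le> g v) \<and>
                integrable lebesgue (\<lambda>v. \<nu> v * (1 + (norm v)\<^sup>2) * g v) \<and>
                \<not> (AE v in lebesgue. g v = 0)}"

text \<open>
  The moment constraint is an integral with values in the 5-dimensional space. Its integrand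
  is integrable for \<open>f\<close> in \<open>D_set \<nu>\<close>, since each component of the moment vector is bounded
  by a multiple of \<open>1 + (norm v)\<^sup>2\<close>.
\<close>
definition chi_set ::
  "real \<Rightarrow> (velocity \<Rightarrow> real) \<Rightarrow> (velocity \<Rightarrow> real) \<Rightarrow> (velocity \<Rightarrow> real) set" where
  "chi_set m \<nu> f = {g. (AE v in lebesgue. 0 \<le> g v) \<and>
                integrable lebesgue (\<lambda>v. \<nu> v * (1 + (norm v)\<^sup>2) * g v) \<and>
                (\<integral>v. (\<nu> v * (g v - f v)) *\<^sub>R moment_vec m v \<partial>lebesgue) = 0}"

text \<open>
  The extended-real integral of \<open>\<nu> h(g)\<close>: integral of the positive part minus integral of the
  negative part. The latter is finite on \<open>chi_set m \<nu> f\<close> whenever \<open>exp_mult m l\<close> is in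
  \<open>D_set \<nu>\<close> for some \<open>l\<close>, because \<open>h z \<ge> z * c - exp c\<close> for all \<open>z \<ge> 0\<close> and all \<open>c\<close>;
  so the undetermined form infinity minus infinity does not occur there.
\<close>
definition entropy :: "(velocity \<Rightarrow> real) \<Rightarrow> (velocity \<Rightarrow> real) \<Rightarrow> ereal" where
  "entropy \<nu> g =
     enn2ereal (\<integral>\<^sup>+v. ennreal (\<nu> v * h (g v)) \<partial>lebesgue) -
     enn2ereal (\<integral>\<^sup>+v. ennreal (- (\<nu> v * h (g v))) \<partial>lebesgue)"

definition solves_min ::
  "real \<Rightarrow> (velocity \<Rightarrow> real) \<Rightarrow> (velocity \<Rightarrow> real) \<Rightarrow> (velocity \<Rightarrow> real) \<Rightarrow> bool" where
  "solves_min m \<nu> f M \<longleftrightarrow>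
     M \<in> chi_set m \<nu> f \<and> (\<forall>g \<in> chi_set m \<nu> f. entropy \<nu> M \<le> entropy \<nu> g)"

end

theory Submission
  imports Defs
begin

text \<open>
  Writing \<open>b\<close> for the moments of \<open>f\<close> and \<open>a\<close> for the moment vector, the multiplier is the minimiser
  over \<open>snd (snd l) < 0\<close> of the dual function \<open>J l = \<integral> \<nu> exp (l \<bullet> a) - l \<bullet> b\<close>, whose
  critical points are exactly the \<open>l\<close> with \<open>exp (l \<bullet> a)\<close> admissible. If \<open>J\<close> stayed bounded above along a
  sequence going to infinity in a direction \<open>e\<close>, then \<open>e \<bullet> a \<le> 0\<close> almost everywhere and
  \<open>e \<bullet> b \<ge> 0\<close>, which forces \<open>f = 0\<close> almost everywhere; so minimising sequences have limit
  points. Minimality of an admissible exponential is the tangent inequality for the convex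
  function \<open>h\<close>, the tangent at \<open>exp (l \<bullet> a)\<close> being an affine function of the prescribed moments.
  Uniqueness holds because \<open>exp\<close> is strictly increasing and \<open>l \<bullet> a\<close> vanishes only on a null set
  for \<open>l \<noteq> 0\<close>.
\<close>

section \<open>Fatou's lemma for real integrals and difference quotients of
  \<open>exp\<close>\<close>

text \<open>Integrability of the limit is a conclusion here: the lemma is applied to limits that
  could lie on the boundary of the domain of the dual. The bounds may vary with \<open>n\<close>, so
  that it also yields lower semicontinuity.\<close>

lemma fatou_integral:
  fixes u :: "nat \<Rightarrow> 'a \<Rightarrow> real"
  assumes u: "\<And>n. integrable M (u n)" and u0: "\<And>n. AE x in M. 0 \<le> u n x"
    and w [measurable]: "w \<in> borel_measurable M"
    and lim: "AE x in M. (\<lambda>n. u n x) \<longlonglongrightarrow> w x"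
    and bound: "\<And>n. integral\<^sup>L M (u n) \<le> c n" and c: "c \<longlonglongrightarrow> C"
  shows "integrable M w" and "integral\<^sup>L M w \<le> C"
proof -
  note [measurable] = borel_measurable_integrable[OF u]
  have "AE x in M. \<forall>n. 0 \<le> u n x"
    using u0 by (simp add: AE_all_countable)
  then have w0: "AE x in M. 0 \<le> w x"
    using lim by eventually_elim (auto intro: LIMSEQ_le_const)
  have "0 \<le> c n" for n
    using integral_nonneg_AE[OF u0[of n]] bound[of n] by linarith
  then have C0: "0 \<le> C"
    using c by (auto intro: LIMSEQ_le_const)
  have "(\<integral>\<^sup>+x. ennreal (w x) \<partial>M) = (\<integral>\<^sup>+x. liminf (\<lambda>n. ennreal (u n x)) \<partial>M)"
  proof (rule nn_integral_cong_AE)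
    show "AE x in M. ennreal (w x) = liminf (\<lambda>n. ennreal (u n x))"
      using lim by eventually_elim (metis lim_imp_Liminf sequentially_bot tendsto_ennrealI)
  qed
  also have "\<dots> \<le> liminf (\<lambda>n. \<integral>\<^sup>+x. ennreal (u n x) \<partial>M)"
    by (rule nn_integral_liminf) simp
  also have "\<dots> \<le> liminf (\<lambda>n. ennreal (c n))"
    by (intro Liminf_mono always_eventually allI)
      (simp add: nn_integral_eq_integral[OF u u0] bound ennreal_leI)
  also have "\<dots> = ennreal C"
    using c by (metis lim_imp_Liminf sequentially_bot tendsto_ennrealI)
  finally have le: "(\<integral>\<^sup>+x. ennreal (w x) \<partial>M) \<le> ennreal C" .
  show int: "integrable M w"
    using le w0 by (intro integrableI_nonneg) (auto simp: le_less_trans)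
  show "integral\<^sup>L M w \<le> C"
    using le C0 by (simp add: nn_integral_eq_integral[OF int w0])
qed

lemma exp_quotient_tendsto:
  fixes x :: real
  assumes "t \<longlonglongrightarrow> 0" and "\<And>n. t n \<noteq> 0"
  shows "(\<lambda>n. (exp (t n * x) - 1) / t n) \<longlonglongrightarrow> x"
proof -
  have "((\<lambda>s. exp (s * x)) has_field_derivative x) (at 0)"
    by (auto intro!: derivative_eq_intros)
  then have "((\<lambda>s. (exp (s * x) - 1) / s) \<longlongrightarrow> x) (at 0)"
    by (simp add: has_field_derivative_iff)
  moreover have "filterlim t (at 0) sequentially"
    using assms by (simp add: filterlim_at)
  ultimately show ?thesis
    by (rule filterlim_compose)
qed

lemma exp_quotient_lower:
  fixes x t :: real
  assumes "0 < t"
  shows "x \<le> (exp (t * x) - 1) / t"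
proof -
  have "x * t \<le> exp (t * x) - 1"
    using exp_ge_add_one_self[of "t * x"] by (simp only: mult.commute[of x t])
  then show ?thesis
    using assms by (simp add: pos_le_divide_eq)
qed

text \<open>By convexity the secant slopes of \<open>exp\<close> from 0 increase,
  \<open>s * x\<close> being the convex combination of 0 and \<open>t * x\<close> with weight
  \<open>s / t\<close>. Together with \<open>exp_quotient_lower\<close> this traps all quotients
  with small step between two fixed functions.\<close>

lemma exp_quotient_mono:
  fixes x s t :: real
  assumes "0 < s" "s \<le> t"
  shows "(exp (s * x) - 1) / s \<le> (exp (t * x) - 1) / t"
proof -
  have "exp ((1 - s / t) *\<^sub>R 0 + (s / t) *\<^sub>R (t * x)) \<le> (1 - s / t) * exp 0 + (s / t) * exp (t * x)"
    using assms by (intro convex_onD[OF exp_convex]) auto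
  then have "(exp (s * x) - 1) / s \<le> ((s / t) * (exp (t * x) - 1)) / s"
    using assms by (intro divide_right_mono) (simp_all add: algebra_simps)
  also have "\<dots> = (exp (t * x) - 1) / t"
    using assms by simp
  finally show ?thesis .
qed

section \<open>Zero sets of quadratic polynomials\<close>

lemma not_AE_lebesgue_False: "\<not> (AE x :: 'a::euclidean_space in lebesgue. False)"
  by (simp add: eventually_False ae_filter_eq_bot_iff emeasure_lborel_UNIV)

lemma AE_quadratic_nonzero:
  fixes b :: "'a::euclidean_space"
  assumes "(a, b, c) \<noteq> 0"
  shows "AE x in lebesgue. a + b \<bullet> x + c * (norm x)\<^sup>2 \<noteq> 0"
proof -
  have "negligible {x. a + b \<bullet> x + c * (norm x)\<^sup>2 = 0}"
  proof (cases "c = 0")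
    case True
    then have "{x. a + b \<bullet> x + c * (norm x)\<^sup>2 = 0} = {x. b \<bullet> x = - a}"
      by auto
    \<comment> \<open>The set is a hyperplane, or empty when \<open>b = 0\<close> and
      \<open>a\<close> is nonzero; \<open>negligible_hyperplane\<close> covers both.\<close>
    moreover have "b \<noteq> 0 \<or> - a \<noteq> 0"
      using assms True by (auto simp: zero_prod_def)
    ultimately show ?thesis
      by (simp only: negligible_hyperplane)
  next
    case False
    \<comment> \<open>Completing the square puts the zeros on a sphere with this centre.\<close>
    define p where "p = (- 1 / (2 * c)) *\<^sub>R b"
    have "x \<in> sphere p (sqrt ((norm p)\<^sup>2 - a / c))" if "a + b \<bullet> x + c * (norm x)\<^sup>2 = 0" for x
    proof -
      have "(dist p x)\<^sup>2 = (norm x)\<^sup>2 - 2 * (p \<bullet> x) + (norm p)\<^sup>2"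
        by (simp add: dist_norm power2_norm_eq_inner inner_diff inner_commute)
      also have "\<dots> = (norm p)\<^sup>2 - a / c"
      proof -
        have "(norm x)\<^sup>2 = (- a - b \<bullet> x) / c"
          using that False by (simp add: field_simps)
        then show ?thesis
          using False by (simp add: p_def diff_divide_distrib)
      qed
      finally show ?thesis
        by (metis mem_sphere real_sqrt_abs abs_of_nonneg zero_le_dist)
    qed
    then show ?thesis
      by (intro negligible_subset[OF negligible_sphere]) blast
  qed
  then show ?thesis
    by (intro AE_I') (auto simp: negligible_iff_null_sets)
qed

section \<open>The entropy density and the extended-real entropy\<close>

lemma h_exp: "h (exp x) = exp x * (x - 1)"
  by (simp add: h_def algebra_simps)

text \<open>Convexity of \<open>h\<close>: its graph lies above the tangent at \<open>exp x\<close>, whose slope is \<open>x\<close>.\<close>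
lemma h_tangent:
  assumes "0 \<le> z"
  shows "h (exp x) + x * (z - exp x) \<le> h z"
proof (cases "z = 0")
  case False
  then have z: "0 < z"
    using assms by simp
  have "ln (exp x / z) \<le> exp x / z - 1"
    using z by (intro ln_le_minus_one) simp
  then have "z * (x - ln z) \<le> z * (exp x / z - 1)"
    using z by (intro mult_left_mono) (simp_all add: ln_div)
  then have "z * (x - ln z) \<le> exp x - z"
    using z by (simp add: right_diff_distrib)
  then show ?thesis
    using z by (simp add: h_exp h_def[of z] algebra_simps)
qed (simp add: h_exp h_def[of 0] algebra_simps)

text \<open>An integrable minorant bounds the positive part from below and the negative part from
  above, both by finite numbers. Hence the difference is monotone even if
  \<open>entropy \<nu> g\<close> is infinite.\<close>

lemma entropy_ge_integral:
  assumes \<phi>: "integrable lebesgue \<phi>" and le: "AE v in lebesgue. \<phi> v \<le> \<nu> v * h (g v)"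
  shows "ereal (integral\<^sup>L lebesgue \<phi>) \<le> entropy \<nu> g"
proof -
  obtain r q where rq: "0 \<le> r" "0 \<le> q" "(\<integral>\<^sup>+v. ennreal (\<phi> v) \<partial>lebesgue) = ennreal r"
    "(\<integral>\<^sup>+v. ennreal (- \<phi> v) \<partial>lebesgue) = ennreal q" "integral\<^sup>L lebesgue \<phi> = r - q"
    using integrableE[OF \<phi>] by metis
  have "ennreal r \<le> (\<integral>\<^sup>+v. ennreal (\<nu> v * h (g v)) \<partial>lebesgue)"
    unfolding rq(3)[symmetric] using le by (intro nn_integral_mono_AE) (elim eventually_mono, simp add: ennreal_leI)
  moreover have "(\<integral>\<^sup>+v. ennreal (- (\<nu> v * h (g v))) \<partial>lebesgue) \<le> ennreal q"
    unfolding rq(4)[symmetric] using le by (intro nn_integral_mono_AE) (elim eventually_mono, simp add: ennreal_leI)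
  ultimately have "enn2ereal (ennreal r) - enn2ereal (ennreal q) \<le> entropy \<nu> g"
    unfolding entropy_def by (intro ereal_minus_mono) (simp_all add: less_eq_ennreal.rep_eq)
  then show ?thesis
    using rq by (simp add: enn2ereal_ennreal)
qed

lemma entropy_eq_integral:
  assumes "integrable lebesgue (\<lambda>v. \<nu> v * h (g v))"
  shows "entropy \<nu> g = ereal (\<integral>v. \<nu> v * h (g v) \<partial>lebesgue)"
  using assms
  by (rule integrableE) (simp add: entropy_def enn2ereal_ennreal)

section \<open>The moment vector and its exponentials\<close>

lemma norm_moment_vec_le:
  assumes "0 \<le> m"
  shows "norm (moment_vec m v) \<le> 2 * m * (1 + (norm v)\<^sup>2)"
proof -
  have "norm (moment_vec m v) \<le> m + (m * norm v + m * (norm v)\<^sup>2)"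
    unfolding moment_vec_def using assms
    by (intro order_trans[OF norm_Pair_le] add_mono) (auto simp: abs_mult)
  also have "\<dots> = m * (1 + norm v + (norm v)\<^sup>2)"
    by (simp add: algebra_simps)
  also have "\<dots> \<le> m * (2 * (1 + (norm v)\<^sup>2))"
  proof (rule mult_left_mono)
    \<comment> \<open>This sum of squares is twice the gap in the inequality below.\<close>
    have "0 \<le> (norm v - 1)\<^sup>2 + (norm v)\<^sup>2 + 1"
      by simp
    then show "1 + norm v + (norm v)\<^sup>2 \<le> 2 * (1 + (norm v)\<^sup>2)"
      by (simp add: power2_eq_square algebra_simps)
  qed (fact assms)
  finally show ?thesis
    by (simp only: mult_ac)
qed

lemma borel_measurable_moment_vec [measurable]: "moment_vec m \<in> borel_measurable lebesgue"
proof -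
  have "continuous_on UNIV (moment_vec m)"
    unfolding moment_vec_def by (intro continuous_intros)
  then show ?thesis
    by (intro measurable_completion) (simp add: borel_measurable_continuous_onI)
qed

lemma borel_measurable_exp_mult [measurable]: "exp_mult m l \<in> borel_measurable lebesgue"
  unfolding exp_mult_def by measurable

lemma exp_mult_pos: "0 < exp_mult m l v"
  by (simp add: exp_mult_def)

lemma exp_mult_add_scaleR:
  "exp_mult m (l + t *\<^sub>R d) v = exp_mult m l v * exp (t * (d \<bullet> moment_vec m v))"
  by (simp add: exp_mult_def inner_add_left exp_add)

lemma AE_inner_moment_vec_nonzero:
  assumes "m \<noteq> 0" "l \<noteq> 0"
  shows "AE v in lebesgue. l \<bullet> moment_vec m v \<noteq> 0"
proof -
  obtain a b c where l: "l = (a, b, c)"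
    by (cases l)
  have "l \<bullet> moment_vec m v = m * (a + b \<bullet> v + c * (norm v)\<^sup>2)" for v
    by (simp add: l moment_vec_def algebra_simps)
  then show ?thesis
    using AE_quadratic_nonzero[of a b c] assms l by simp
qed

section \<open>Moments, integrability and admissibility\<close>

locale moment_problem =
  fixes m :: real and \<nu> f :: "velocity \<Rightarrow> real"
  assumes m_pos: "0 < m"
    and \<nu>_measurable [measurable]: "\<nu> \<in> borel_measurable lebesgue"
    and \<nu>_pos: "\<And>v. 0 < \<nu> v"
    and exp_mult_integrable_iff:
      "\<And>l. integrable lebesgue (\<lambda>v. \<nu> v * (1 + (norm v)\<^sup>2) * exp_mult m l v) \<longleftrightarrow> snd (snd l) < 0"
    and f_D: "f \<in> D_set \<nu>"
begin

definition moments_of :: "(velocity \<Rightarrow> real) \<Rightarrow> moments" where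
  "moments_of g = (\<integral>v. (\<nu> v * g v) *\<^sub>R moment_vec m v \<partial>lebesgue)"

text \<open>Where the integral diverges, the Bochner integral has the default value 0. Values on the
  boundary \<open>snd (snd l) = 0\<close> are therefore meaningful only together with a proof of
  integrability.\<close>

definition partition_function :: "moments \<Rightarrow> real" where
  "partition_function l = (\<integral>v. \<nu> v * exp_mult m l v \<partial>lebesgue)"

text \<open>The convex Lagrange dual, up to sign. Its gradient at \<open>l\<close> is
  \<open>moments_of (exp_mult m l) - moments_of f\<close>.\<close>

definition dual :: "moments \<Rightarrow> real" where
  "dual l = partition_function l - l \<bullet> moments_of f"

lemma f_nonneg: "AE v in lebesgue. 0 \<le> f v"
  and f_integrable: "integrable lebesgue (\<lambda>v. \<nu> v * (1 + (norm v)\<^sup>2) * f v)"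
  and f_nonzero: "\<not> (AE v in lebesgue. f v = 0)"
  using f_D by (simp_all add: D_set_def)

text \<open>\<open>D_set\<close> and \<open>chi_set\<close> require only the weighted product to be
  integrable. Dividing by the weight, which never vanishes, recovers measurability of
  \<open>g\<close> itself.\<close>

lemma density_measurable:
  assumes "integrable lebesgue (\<lambda>v. \<nu> v * (1 + (norm v)\<^sup>2) * g v)"
  shows "g \<in> borel_measurable lebesgue"
proof -
  have [measurable]: "(\<lambda>v. \<nu> v * (1 + (norm v)\<^sup>2) * g v) \<in> borel_measurable lebesgue"
    using assms by simp
  have [measurable]: "(\<lambda>v::velocity. norm v) \<in> borel_measurable lebesgue"
    by (intro measurable_completion) simp
  have "\<nu> v \<noteq> 0" "1 + (norm v)\<^sup>2 \<noteq> 0" for v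
    using \<nu>_pos[of v] by (auto simp: add_nonneg_eq_0_iff)
  then have "g = (\<lambda>v. (\<nu> v * (1 + (norm v)\<^sup>2) * g v) / (\<nu> v * (1 + (norm v)\<^sup>2)))"
    by simp
  also have "\<dots> \<in> borel_measurable lebesgue"
    by measurable
  finally show ?thesis .
qed

lemma moment_integrable:
  assumes "integrable lebesgue (\<lambda>v. \<nu> v * (1 + (norm v)\<^sup>2) * g v)"
  shows "integrable lebesgue (\<lambda>v. (\<nu> v * g v) *\<^sub>R moment_vec m v)"
proof (rule Bochner_Integration.integrable_bound)
  show "integrable lebesgue (\<lambda>v. (2 * m) * (\<nu> v * (1 + (norm v)\<^sup>2) * g v))"
    using assms by (intro integrable_mult_right)
  have [measurable]: "g \<in> borel_measurable lebesgue"
    by (rule density_measurable[OF assms])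
  show "(\<lambda>v. (\<nu> v * g v) *\<^sub>R moment_vec m v) \<in> borel_measurable lebesgue"
    by measurable
  have "norm ((\<nu> v * g v) *\<^sub>R moment_vec m v) \<le> norm ((2 * m) * (\<nu> v * (1 + (norm v)\<^sup>2) * g v))" for v
  proof -
    have "norm ((\<nu> v * g v) *\<^sub>R moment_vec m v) \<le> \<bar>\<nu> v * g v\<bar> * (2 * m * (1 + (norm v)\<^sup>2))"
      using norm_moment_vec_le[of m v] m_pos by (simp add: mult_left_mono)
    also have "\<dots> = norm ((2 * m) * (\<nu> v * (1 + (norm v)\<^sup>2) * g v))"
      using m_pos by (simp add: abs_mult mult_ac add_pos_nonneg)
    finally show ?thesis .
  qed
  then show "AE v in lebesgue. norm ((\<nu> v * g v) *\<^sub>R moment_vec m v)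
      \<le> norm ((2 * m) * (\<nu> v * (1 + (norm v)\<^sup>2) * g v))"
    by simp
qed

lemma
  assumes "integrable lebesgue (\<lambda>v. \<nu> v * (1 + (norm v)\<^sup>2) * g v)"
  shows inner_moment_integrable: "integrable lebesgue (\<lambda>v. \<nu> v * g v * (l \<bullet> moment_vec m v))"
    and integral_inner_moment:
      "(\<integral>v. \<nu> v * g v * (l \<bullet> moment_vec m v) \<partial>lebesgue) = l \<bullet> moments_of g"
  using integrable_inner_right[of l, OF moment_integrable[OF assms]]
    integral_inner_right[of l, OF moment_integrable[OF assms]]
  by (simp_all add: moments_of_def)

text \<open>Pairing with \<open>(1, 0, 0)\<close> selects the constant component \<open>m\<close> of
  the moment vector.\<close>

lemma density_integrable:
  assumes "integrable lebesgue (\<lambda>v. \<nu> v * (1 + (norm v)\<^sup>2) * g v)"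
  shows "integrable lebesgue (\<lambda>v. \<nu> v * g v)"
  using integrable_divide[OF inner_moment_integrable[OF assms, of "(1, 0, 0)"], of m] m_pos
  by (simp add: moment_vec_def)

lemma chi_set_iff:
  "g \<in> chi_set m \<nu> f \<longleftrightarrow> (AE v in lebesgue. 0 \<le> g v) \<and>
    integrable lebesgue (\<lambda>v. \<nu> v * (1 + (norm v)\<^sup>2) * g v) \<and> moments_of g = moments_of f"
proof -
  have "(\<integral>v. (\<nu> v * (g v - f v)) *\<^sub>R moment_vec m v \<partial>lebesgue) = moments_of g - moments_of f"
    if "integrable lebesgue (\<lambda>v. \<nu> v * (1 + (norm v)\<^sup>2) * g v)"
    unfolding moments_of_def
    using Bochner_Integration.integral_diff[OF moment_integrable[OF that] moment_integrable[OF f_integrable]]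
    by (simp add: algebra_simps)
  then show ?thesis
    by (auto simp: chi_set_def)
qed

lemma partition_function_integrable:
  assumes "snd (snd l) < 0"
  shows "integrable lebesgue (\<lambda>v. \<nu> v * exp_mult m l v)"
  using assms by (intro density_integrable) (simp add: exp_mult_integrable_iff)

lemma partition_function_nonneg: "0 \<le> partition_function l"
  unfolding partition_function_def
  by (intro integral_nonneg_AE) (simp add: \<nu>_pos exp_mult_pos less_imp_le)

section \<open>Optimality and uniqueness of an admissible exponential\<close>

lemma exp_mult_solves_min:
  assumes chi: "exp_mult m l \<in> chi_set m \<nu> f"
  shows "solves_min m \<nu> f (exp_mult m l)"
  unfolding solves_min_def
proof (intro conjI ballI)
  fix g assume "g \<in> chi_set m \<nu> f"
  then have g0: "AE v in lebesgue. 0 \<le> g v"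
    and g: "integrable lebesgue (\<lambda>v. \<nu> v * (1 + (norm v)\<^sup>2) * g v)"
    and g_eq: "moments_of g = moments_of f"
    by (simp_all add: chi_set_iff)
  have M: "integrable lebesgue (\<lambda>v. \<nu> v * (1 + (norm v)\<^sup>2) * exp_mult m l v)"
    and M_eq: "moments_of (exp_mult m l) = moments_of f"
    using chi by (simp_all add: chi_set_iff)
  let ?x = "\<lambda>v. l \<bullet> moment_vec m v"
  have hM_eq: "\<nu> v * h (exp_mult m l v) = \<nu> v * exp_mult m l v * ?x v - \<nu> v * exp_mult m l v" for v
    by (simp add: exp_mult_def h_exp algebra_simps)
  have hM: "integrable lebesgue (\<lambda>v. \<nu> v * h (exp_mult m l v))"
    unfolding hM_eq
    by (intro Bochner_Integration.integrable_diff inner_moment_integrable density_integrable M)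
  \<comment> \<open>The tangent minorant of \<open>\<nu> v * h (g v)\<close>. Its correction term
    integrates to \<open>l\<close> paired with the difference of the moments of \<open>g\<close> and
    of the exponential, which is 0.\<close>
  define \<phi> where "\<phi> v = \<nu> v * h (exp_mult m l v) +
    (\<nu> v * g v * ?x v - \<nu> v * exp_mult m l v * ?x v)" for v
  have \<phi>: "integrable lebesgue \<phi>"
    unfolding \<phi>_def
    by (intro Bochner_Integration.integrable_add Bochner_Integration.integrable_diff
        hM inner_moment_integrable M g)
  have "integral\<^sup>L lebesgue \<phi> = (\<integral>v. \<nu> v * h (exp_mult m l v) \<partial>lebesgue)"
    unfolding \<phi>_def using hM inner_moment_integrable[OF M, of l] inner_moment_integrable[OF g, of l]
    by (simp add: integral_inner_moment M g M_eq g_eq)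
  then have "entropy \<nu> (exp_mult m l) = ereal (integral\<^sup>L lebesgue \<phi>)"
    by (simp add: entropy_eq_integral[OF hM])
  also have "\<dots> \<le> entropy \<nu> g"
  proof (rule entropy_ge_integral[OF \<phi>])
    show "AE v in lebesgue. \<phi> v \<le> \<nu> v * h (g v)"
      using g0
    proof eventually_elim
      case (elim v)
      have "\<phi> v = \<nu> v * (h (exp_mult m l v) + ?x v * (g v - exp_mult m l v))"
        by (simp add: \<phi>_def algebra_simps)
      also have "\<dots> \<le> \<nu> v * h (g v)"
        using h_tangent[OF elim] \<nu>_pos[of v] by (simp add: exp_mult_def)
      finally show ?case .
    qed
  qed
  finally show "entropy \<nu> (exp_mult m l) \<le> entropy \<nu> g" .
qed (fact chi)

text \<open>The difference of the two exponentials is tested against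
  \<open>d \<bullet> moment_vec m v\<close>. Equal moments make the integral 0, while monotonicity
  of \<open>exp\<close> makes the integrand nonnegative, and positive wherever the pairing is
  nonzero.\<close>

lemma exp_mult_chi_unique:
  assumes "exp_mult m l \<in> chi_set m \<nu> f" "exp_mult m l' \<in> chi_set m \<nu> f"
  shows "l = l'"
proof (rule ccontr)
  assume "l \<noteq> l'"
  define d where "d = l - l'"
  let ?x = "\<lambda>v. d \<bullet> moment_vec m v"
  let ?u = "\<lambda>v. \<nu> v * exp_mult m l v * ?x v - \<nu> v * exp_mult m l' v * ?x v"
  have M: "integrable lebesgue (\<lambda>v. \<nu> v * (1 + (norm v)\<^sup>2) * exp_mult m l v)"
    "integrable lebesgue (\<lambda>v. \<nu> v * (1 + (norm v)\<^sup>2) * exp_mult m l' v)"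
    and eq: "moments_of (exp_mult m l) = moments_of (exp_mult m l')"
    using assms by (simp_all add: chi_set_iff)
  have u: "integrable lebesgue ?u" and u0: "integral\<^sup>L lebesgue ?u = 0"
    using inner_moment_integrable[OF M(1), of d] inner_moment_integrable[OF M(2), of d]
    by (simp_all add: integral_inner_moment M eq)
  have u_eq: "?u v = \<nu> v * exp_mult m l' v * (?x v * (exp (?x v) - 1))" for v
    using exp_mult_add_scaleR[of m l' 1 d v] by (simp add: d_def algebra_simps)
  have pos: "0 < x * (exp x - 1)" if "x \<noteq> 0" for x :: real
    using that by (cases "0 < x") (auto intro: mult_neg_neg)
  have "0 \<le> ?u v" for v
    unfolding u_eq using pos[of "?x v"] \<nu>_pos[of v] exp_mult_pos[of m l' v]
    by (cases "?x v = 0") (auto simp: less_imp_le)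
  then have "AE v in lebesgue. ?u v = 0"
    using u u0 by (simp add: integral_nonneg_eq_0_iff_AE)
  moreover have "AE v in lebesgue. ?x v \<noteq> 0"
    using m_pos \<open>l \<noteq> l'\<close> by (intro AE_inner_moment_vec_nonzero) (auto simp: d_def)
  ultimately have "AE v::velocity in lebesgue. False"
  proof eventually_elim
    case (elim v)
    then show ?case
      using pos[of "?x v"] \<nu>_pos[of v] exp_mult_pos[of m l' v] unfolding u_eq by auto
  qed
  then show False
    by (simp add: not_AE_lebesgue_False)
qed

section \<open>Existence of a minimiser of the dual\<close>

text \<open>
  Scaling out the norm \<open>t\<close> of \<open>l\<close> and bounding \<open>exp (t y) \<ge> t\<^sup>2 y\<^sup>2 / 2\<close> for \<open>y \<ge> 0\<close> makes
  the integral of \<open>\<nu> (max 0 y)\<^sup>2\<close> vanish in the limit, by Fatou.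
\<close>
lemma dual_sublevel_bounded:
  assumes dom: "\<And>n. snd (snd (l n)) < 0" and le: "\<And>n. dual (l n) \<le> C"
  shows "bounded (range (l :: nat \<Rightarrow> moments))"
proof (rule ccontr)
  assume "\<not> bounded (range l)"
  \<comment> \<open>The extra 1 keeps the norms away from 0 and makes their reciprocals at most
    \<open>inverse (real (Suc n))\<close>.\<close>
  then have "\<exists>k. real n + 1 < norm (l k)" for n
    by (auto simp: bounded_iff not_le)
  then obtain k where k: "\<And>n. real n + 1 < norm (l (k n))"
    by metis
  define d where "d n = l (k n) /\<^sub>R norm (l (k n))" for n
  have "d n \<in> sphere 0 1" for n
  proof -
    have "l (k n) \<noteq> 0"
      using k[of n] by auto
    then show ?thesis
      by (simp add: d_def)
  qed
  then obtain e r where e: "e \<in> sphere 0 1" and r: "strict_mono r" and lim: "(d \<circ> r) \<longlonglongrightarrow> e"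
    using compact_sphere[of "0::moments" 1] unfolding compact_def by metis
  define t where "t n = norm (l (k (r n)))" for n
  have t: "real n + 1 < t n" for n
    using k[of "r n"] seq_suble[OF r, of n] by (simp add: t_def)
  have t_pos: "0 < t n" for n
    using t[of n] by linarith
  have t_inv: "(\<lambda>n. 1 / t n) \<longlonglongrightarrow> 0"
  proof (rule tendsto_sandwich[OF _ _ tendsto_const LIMSEQ_inverse_real_of_nat])
    show "\<forall>\<^sub>F n in sequentially. 0 \<le> 1 / t n"
      using t_pos by (simp add: less_imp_le)
    show "\<forall>\<^sub>F n in sequentially. 1 / t n \<le> inverse (real (Suc n))"
      using t by (intro always_eventually allI) (simp add: inverse_eq_divide frac_le less_imp_le add.commute)
  qed
  define c where "c n = d (r n)" for n
  have l_eq: "l (k (r n)) = t n *\<^sub>R c n" for n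
    using t_pos[of n] by (simp add: c_def d_def t_def)
  have c_lim: "c \<longlonglongrightarrow> e"
    using lim by (simp add: c_def [abs_def] o_def)
  let ?b = "moments_of f"
  let ?E = "\<lambda>n v. \<nu> v * exp_mult m (l (k (r n))) v"
  have part: "partition_function (l (k (r n))) \<le> C + t n * (c n \<bullet> ?b)" for n
    using le[of "k (r n)"] by (simp add: dual_def l_eq)
  \<comment> \<open>Divide \<open>part\<close> by \<open>t n\<close>: the partition function is
    nonnegative and \<open>C / t n\<close> vanishes in the limit.\<close>
  have eb: "0 \<le> e \<bullet> ?b"
  proof (rule LIMSEQ_le_const)
    have "(\<lambda>n. C * (1 / t n) + c n \<bullet> ?b) \<longlonglongrightarrow> C * 0 + e \<bullet> ?b"
      by (intro tendsto_intros t_inv c_lim)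
    then show "(\<lambda>n. C * (1 / t n) + c n \<bullet> ?b) \<longlonglongrightarrow> e \<bullet> ?b"
      by simp
    have "0 \<le> C * (1 / t n) + c n \<bullet> ?b" for n
    proof -
      have "0 \<le> (C + t n * (c n \<bullet> ?b)) / t n"
        using part[of n] partition_function_nonneg[of "l (k (r n))"] t_pos[of n] by simp
      also have "\<dots> = C * (1 / t n) + c n \<bullet> ?b"
        using t_pos[of n] by (simp add: add_divide_distrib)
      finally show ?thesis .
    qed
    then show "\<exists>N. \<forall>n\<ge>N. 0 \<le> C * (1 / t n) + c n \<bullet> ?b"
      by blast
  qed
  \<comment> \<open>Quadratic growth suffices: after division by the square of \<open>t n\<close>,
    the linear term on the right of \<open>part\<close> still tends to 0.\<close>
  define u where "u y v = \<nu> v * (max 0 (y \<bullet> moment_vec m v))\<^sup>2 / 2" for y v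
  have u_meas [measurable]: "u y \<in> borel_measurable lebesgue" for y
    unfolding u_def by measurable
  have u0: "0 \<le> u y v" for y v
    using \<nu>_pos[of v] by (simp add: u_def)
  have E: "integrable lebesgue (?E n)" for n
    by (rule partition_function_integrable[OF dom])
  have u_le: "u (c n) v \<le> ?E n v * (1 / t n)\<^sup>2" for n v
  proof -
    let ?y = "max 0 (c n \<bullet> moment_vec m v)"
    have "(t n * ?y)\<^sup>2 / 2 \<le> exp (t n * (c n \<bullet> moment_vec m v))"
    proof (cases "0 \<le> c n \<bullet> moment_vec m v")
      case True
      then have nonneg: "0 \<le> t n * ?y"
        using t_pos[of n] by simp
      have "(t n * ?y)\<^sup>2 / 2 \<le> exp (t n * ?y)"
        using exp_lower_Taylor_quadratic[OF nonneg] nonneg by linarith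
      then show ?thesis
        using True by simp
    qed simp
    then have "(?y)\<^sup>2 / 2 \<le> exp (t n * (c n \<bullet> moment_vec m v)) * (1 / t n)\<^sup>2"
      using t_pos[of n] by (simp add: power_mult_distrib power_divide field_simps)
    then have "\<nu> v * ((?y)\<^sup>2 / 2) \<le> \<nu> v * (exp (t n * (c n \<bullet> moment_vec m v)) * (1 / t n)\<^sup>2)"
      using \<nu>_pos[of v] by (intro mult_left_mono) auto
    then show ?thesis
      by (simp add: u_def l_eq exp_mult_def mult.assoc)
  qed
  have u_int: "integrable lebesgue (u (c n))" for n
  proof (rule Bochner_Integration.integrable_bound[OF integrable_mult_left])
    show "integrable lebesgue (?E n)"
      by (rule E)
    show "AE v in lebesgue. norm (u (c n) v) \<le> norm (?E n v * (1 / t n)\<^sup>2)"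
      using u_le[of n] u0[of "c n"] by (auto intro: order_trans[OF _ abs_ge_self])
  qed simp
  have u_bound: "integral\<^sup>L lebesgue (u (c n)) \<le> C * (1 / t n)\<^sup>2 + (c n \<bullet> ?b) * (1 / t n)" for n
  proof -
    have "integral\<^sup>L lebesgue (u (c n)) \<le> (\<integral>v. ?E n v * (1 / t n)\<^sup>2 \<partial>lebesgue)"
      using E[of n] u_int[of n] u_le[of n] by (intro integral_mono) auto
    also have "\<dots> = partition_function (l (k (r n))) * (1 / t n)\<^sup>2"
      by (simp add: partition_function_def)
    also have "\<dots> \<le> (C + t n * (c n \<bullet> ?b)) * (1 / t n)\<^sup>2"
      using part[of n] by (intro mult_right_mono) auto
    also have "\<dots> = C * (1 / t n)\<^sup>2 + (c n \<bullet> ?b) * (1 / t n)"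
      using t_pos[of n] by (simp add: power2_eq_square field_simps)
    finally show ?thesis .
  qed
  have u_lim: "(\<lambda>n. u (c n) v) \<longlonglongrightarrow> u e v" for v
    unfolding u_def by (intro tendsto_intros c_lim) auto
  have b_lim: "(\<lambda>n. C * (1 / t n)\<^sup>2 + (c n \<bullet> ?b) * (1 / t n)) \<longlonglongrightarrow> C * 0\<^sup>2 + (e \<bullet> ?b) * 0"
    by (intro tendsto_intros t_inv c_lim)
  have ue: "integrable lebesgue (u e)" "integral\<^sup>L lebesgue (u e) \<le> 0"
    using fatou_integral[OF u_int _ u_meas _ u_bound b_lim, of e] u0 u_lim by auto
  moreover have "0 \<le> integral\<^sup>L lebesgue (u e)"
    by (intro integral_nonneg_AE) (simp add: u0)
  ultimately have "integral\<^sup>L lebesgue (u e) = 0"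
    by simp
  then have "AE v in lebesgue. u e v = 0"
    using ue(1) u0 by (simp add: integral_nonneg_eq_0_iff_AE)
  then have neg: "AE v in lebesgue. e \<bullet> moment_vec m v \<le> 0"
  proof eventually_elim
    case (elim v)
    then show ?case
      using \<nu>_pos[of v] by (simp add: u_def max_def split: if_splits)
  qed
  \<comment> \<open>Weighting by \<open>f\<close> makes \<open>?w\<close> nonnegative almost
    everywhere, while \<open>eb\<close> makes its integral nonpositive. So \<open>?w\<close>
    vanishes almost everywhere, and then so does \<open>f\<close>.\<close>
  let ?w = "\<lambda>v. - (\<nu> v * f v * (e \<bullet> moment_vec m v))"
  have w: "integrable lebesgue ?w"
    using inner_moment_integrable[OF f_integrable, of e] by simp
  have w0: "AE v in lebesgue. 0 \<le> ?w v"
    using neg f_nonneg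
  proof eventually_elim
    case (elim v)
    then show ?case
      using \<nu>_pos[of v] by (simp add: mult_nonneg_nonpos less_imp_le)
  qed
  have w_eq: "integral\<^sup>L lebesgue ?w = - (e \<bullet> ?b)"
    by (simp add: integral_inner_moment f_integrable)
  then have "integral\<^sup>L lebesgue ?w = 0"
    using eb integral_nonneg_AE[OF w0] by simp
  then have "AE v in lebesgue. ?w v = 0"
    using integral_nonneg_eq_0_iff_AE[OF w w0] by simp
  moreover have "AE v in lebesgue. e \<bullet> moment_vec m v \<noteq> 0"
    using m_pos e by (intro AE_inner_moment_vec_nonzero) auto
  ultimately have "AE v in lebesgue. f v = 0"
  proof eventually_elim
    case (elim v)
    then show ?case
      using \<nu>_pos[of v] by simp
  qed
  then show False
    using f_nonzero by simp
qed

text \<open>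
  On the boundary \<open>snd (snd l) = 0\<close> the dual may be finite, but its slope in the inward
  direction \<open>(0, 0, -1)\<close> is minus infinity there, so no minimiser lies on the boundary.
\<close>
lemma dual_minimiser_interior:
  assumes int: "integrable lebesgue (\<lambda>v. \<nu> v * exp_mult m l v)" and l: "snd (snd l) \<le> 0"
    and min: "\<And>l'. snd (snd l') < 0 \<Longrightarrow> dual l \<le> dual l'"
  shows "snd (snd l) < 0"
proof -
  define d :: moments where "d = (0, 0, - 1)"
  have dm: "d \<bullet> moment_vec m v = - (m * (norm v)\<^sup>2)" for v
    by (simp add: d_def moment_vec_def)
  define t where "t n = inverse (real (Suc n))" for n
  have t: "t \<longlonglongrightarrow> 0" "\<And>n. 0 < t n"
    unfolding t_def by (fact LIMSEQ_inverse_real_of_nat) simp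
  let ?u = "\<lambda>n v. (\<nu> v * exp_mult m l v - \<nu> v * exp_mult m (l + t n *\<^sub>R d) v) / t n"
  let ?w = "\<lambda>v. - (\<nu> v * exp_mult m l v * (d \<bullet> moment_vec m v))"
  have dom: "snd (snd (l + t n *\<^sub>R d)) < 0" for n
    using l t(2)[of n] by (simp add: d_def)
  have u_eq: "?u n v = - (\<nu> v * exp_mult m l v * ((exp (t n * (d \<bullet> moment_vec m v)) - 1) / t n))" for n v
    by (simp add: exp_mult_add_scaleR algebra_simps diff_divide_distrib)
  \<comment> \<open>Minimality bounds the integrals of the nonnegative difference quotients by a
    constant; Fatou turns this into integrability of the pointwise derivative.\<close>
  have "integrable lebesgue ?w"
  proof (rule fatou_integral(1)[where u = ?u and c = "\<lambda>n. - (d \<bullet> moments_of f)"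
        and C = "- (d \<bullet> moments_of f)"])
    fix n
    show "integrable lebesgue (?u n)"
      by (intro integrable_divide Bochner_Integration.integrable_diff int partition_function_integrable dom)
    show "AE v in lebesgue. 0 \<le> ?u n v"
    proof (intro AE_I2)
      fix v
      have "exp (t n * (d \<bullet> moment_vec m v)) \<le> 1"
        using t(2)[of n] m_pos by (simp add: dm mult_nonneg_nonneg less_imp_le)
      then have "exp_mult m (l + t n *\<^sub>R d) v \<le> exp_mult m l v"
        using exp_mult_pos[of m l v] by (simp add: exp_mult_add_scaleR mult_le_cancel_left1)
      then show "0 \<le> ?u n v"
        using t(2)[of n] \<nu>_pos[of v] by simp
    qed
    have "integral\<^sup>L lebesgue (?u n) = (partition_function l - partition_function (l + t n *\<^sub>R d)) / t n"
      using int partition_function_integrable[OF dom[of n]] by (simp add: partition_function_def)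
    also have "\<dots> \<le> - (d \<bullet> moments_of f)"
      using min[OF dom[of n]] t(2)[of n]
      by (simp add: dual_def inner_add_left pos_divide_le_eq algebra_simps)
    finally show "integral\<^sup>L lebesgue (?u n) \<le> - (d \<bullet> moments_of f)" .
  next
    show "AE v in lebesgue. (\<lambda>n. ?u n v) \<longlonglongrightarrow> ?w v"
      unfolding u_eq using t
      by (intro AE_I2 tendsto_intros exp_quotient_tendsto) (auto simp: less_imp_neq[symmetric])
  qed simp_all
  \<comment> \<open>Since \<open>?w v / m\<close> is the density times the square of
    \<open>norm v\<close>, the sum carries the full weight of
    \<open>exp_mult_integrable_iff\<close>, whose domain is the open half-space.\<close>
  then have "integrable lebesgue (\<lambda>v. \<nu> v * exp_mult m l v + ?w v / m)"
    using int by simp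
  moreover have "\<nu> v * exp_mult m l v + ?w v / m = \<nu> v * (1 + (norm v)\<^sup>2) * exp_mult m l v" for v
    using m_pos by (simp add: dm algebra_simps)
  ultimately show ?thesis
    by (simp add: exp_mult_integrable_iff)
qed

text \<open>The direct method: bounded sublevel sets give a convergent minimising sequence, Fatou
  gives lower semicontinuity, and \<open>dual_minimiser_interior\<close> keeps the limit off the
  boundary.\<close>

lemma dual_has_minimiser:
  obtains l where "snd (snd l) < 0" "\<And>l'. snd (snd l') < 0 \<Longrightarrow> dual l \<le> dual l'"
proof -
  define \<Lambda> where "\<Lambda> = {l :: moments. snd (snd l) < 0}"
  have "(0, 0, - 1) \<in> \<Lambda>"
    by (simp add: \<Lambda>_def)
  then have ne: "dual ` \<Lambda> \<noteq> {}"
    by blast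
  have bdd: "bdd_below (dual ` \<Lambda>)"
  proof (rule ccontr)
    \<comment> \<open>Multipliers with dual values below \<open>- real n\<close> lie in one sublevel
      set, hence are bounded. But the dual is bounded below on bounded sets, by
      Cauchy-Schwarz.\<close>
    assume "\<not> bdd_below (dual ` \<Lambda>)"
    then have "\<exists>l\<in>\<Lambda>. dual l < - real n" for n
      by (auto simp: bdd_below_def not_le)
    then obtain l where l: "\<And>n. l n \<in> \<Lambda>" "\<And>n. dual (l n) < - real n"
      by metis
    have "dual (l n) \<le> 0" for n
      using l(2)[of n] by simp
    then have "bounded (range l)"
      using l(1) by (intro dual_sublevel_bounded[of l 0]) (auto simp: \<Lambda>_def)
    then obtain B where B: "\<And>n. norm (l n) \<le> B"
      by (auto simp: bounded_iff)
    obtain n where n: "B * norm (moments_of f) < real n"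
      using reals_Archimedean2 by blast
    have "l n \<bullet> moments_of f \<le> norm (l n) * norm (moments_of f)"
      by (rule norm_cauchy_schwarz)
    also have "\<dots> \<le> B * norm (moments_of f)"
      using B by (intro mult_right_mono) auto
    finally have "- (B * norm (moments_of f)) \<le> dual (l n)"
      using partition_function_nonneg[of "l n"] by (simp add: dual_def)
    then show False
      using n l(2)[of n] by linarith
  qed
  define I where "I = Inf (dual ` \<Lambda>)"
  have I: "I \<le> dual l" if "l \<in> \<Lambda>" for l
    unfolding I_def using bdd that by (intro cInf_lower) auto
  have "\<exists>l\<in>\<Lambda>. dual l < I + inverse (real (Suc n))" for n
    using cInf_lessD[OF ne, of "I + inverse (real (Suc n))"] by (auto simp: I_def)
  then obtain l where l: "\<And>n. l n \<in> \<Lambda>" "\<And>n. dual (l n) < I + inverse (real (Suc n))"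
    by metis
  have "dual (l n) \<le> I + 1" for n
    using l(2)[of n] by (simp add: inverse_eq_divide) (smt (verit) divide_le_eq_1 of_nat_0_le_iff)
  then have "bounded (range l)"
    using l(1) by (intro dual_sublevel_bounded) (auto simp: \<Lambda>_def)
  then obtain x r where r: "strict_mono r" and x: "(l \<circ> r) \<longlonglongrightarrow> x"
    using bounded_imp_convergent_subsequence by blast
  have lim: "(\<lambda>n. l (r n)) \<longlonglongrightarrow> x"
    using x by (simp add: o_def)
  have "(\<lambda>n. inverse (real (Suc (r n)))) \<longlonglongrightarrow> 0"
    using LIMSEQ_subseq_LIMSEQ[OF LIMSEQ_inverse_real_of_nat r] by (simp add: o_def)
  then have c: "(\<lambda>n. I + inverse (real (Suc (r n))) + l (r n) \<bullet> moments_of f)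
      \<longlonglongrightarrow> I + 0 + x \<bullet> moments_of f"
    by (intro tendsto_intros lim)
  have E: "integrable lebesgue (\<lambda>v. \<nu> v * exp_mult m (l (r n)) v)" for n
    using l(1)[of "r n"] by (intro partition_function_integrable) (simp add: \<Lambda>_def)
  have E_le: "(\<integral>v. \<nu> v * exp_mult m (l (r n)) v \<partial>lebesgue)
      \<le> I + inverse (real (Suc (r n))) + l (r n) \<bullet> moments_of f" for n
    using l(2)[of "r n"] by (simp add: dual_def partition_function_def)
  have E0: "AE v in lebesgue. 0 \<le> \<nu> v * exp_mult m (l (r n)) v" for n
    by (simp add: \<nu>_pos exp_mult_pos less_imp_le)
  have E_lim: "AE v in lebesgue. (\<lambda>n. \<nu> v * exp_mult m (l (r n)) v) \<longlonglongrightarrow> \<nu> v * exp_mult m x v"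
    unfolding exp_mult_def by (intro AE_I2 tendsto_intros lim)
  have x_meas: "(\<lambda>v. \<nu> v * exp_mult m x v) \<in> borel_measurable lebesgue"
    by measurable
  \<comment> \<open>Both conclusions matter: the second bounds \<open>dual x\<close> by the infimum,
    and the first is the integrability required by \<open>dual_minimiser_interior\<close>, since
    \<open>x\<close> is not yet known to be interior.\<close>
  note fatou = fatou_integral[OF E E0 x_meas E_lim E_le c]
  have "dual x \<le> I"
    using fatou(2) by (simp add: dual_def partition_function_def)
  then have min: "dual x \<le> dual l'" if "snd (snd l') < 0" for l'
    using I[of l'] that by (simp add: \<Lambda>_def)
  have "snd (snd x) \<le> 0"
  proof (rule LIMSEQ_le_const2)
    show "(\<lambda>n. snd (snd (l (r n)))) \<longlonglongrightarrow> snd (snd x)"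
      by (intro tendsto_intros lim)
    show "\<exists>N. \<forall>n\<ge>N. snd (snd (l (r n))) \<le> 0"
      using l(1) by (auto simp: \<Lambda>_def less_imp_le)
  qed
  then have "snd (snd x) < 0"
    using fatou(1) min by (intro dual_minimiser_interior)
  then show thesis
    using min that by blast
qed

section \<open>First-order condition at the minimiser\<close>

text \<open>The one-sided derivative of the dual at a minimiser is nonnegative in each direction
  \<open>d\<close>; dominated convergence allows differentiation under the integral.\<close>

lemma dual_minimiser_inner_le:
  assumes l: "snd (snd l) < 0" and min: "\<And>l'. snd (snd l') < 0 \<Longrightarrow> dual l \<le> dual l'"
  shows "d \<bullet> moments_of f \<le> d \<bullet> moments_of (exp_mult m l)"
proof -
  have M: "integrable lebesgue (\<lambda>v. \<nu> v * (1 + (norm v)\<^sup>2) * exp_mult m l v)"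
    using l by (simp add: exp_mult_integrable_iff)
  \<comment> \<open>A step along \<open>d\<close> of length at most \<open>s\<close> uses up at most
    half the distance to the boundary; the added 1 avoids division by 0.\<close>
  define s where "s = - snd (snd l) / (2 * (1 + \<bar>snd (snd d)\<bar>))"
  have s: "0 < s"
    using l by (simp add: s_def divide_neg_pos)
  have "s * snd (snd d) \<le> s * (1 + \<bar>snd (snd d)\<bar>)"
    using s by (intro mult_left_mono) auto
  also have "\<dots> = - snd (snd l) / 2"
    by (simp add: s_def field_simps add_pos_nonneg)
  finally have sd: "s * snd (snd d) \<le> - snd (snd l) / 2" .
  define t where "t n = s * inverse (real (Suc n))" for n
  have t: "0 < t n" "t n \<le> s" for n
    using s by (simp_all add: t_def field_simps)
  have t_lim: "t \<longlonglongrightarrow> 0"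
    unfolding t_def using tendsto_mult_right_zero[OF LIMSEQ_inverse_real_of_nat] by simp
  have dom: "snd (snd (l + \<tau> *\<^sub>R d)) < 0" if "0 < \<tau>" "\<tau> \<le> s" for \<tau>
  proof -
    have "\<tau> * snd (snd d) \<le> max 0 (s * snd (snd d))"
      using that by (cases "0 \<le> snd (snd d)")
        (auto simp: le_max_iff_disj mult_right_mono mult_nonneg_nonpos)
    then show ?thesis
      using sd l by simp
  qed
  let ?x = "\<lambda>v. d \<bullet> moment_vec m v"
  let ?u = "\<lambda>n v. (\<nu> v * exp_mult m (l + t n *\<^sub>R d) v - \<nu> v * exp_mult m l v) / t n"
  let ?w = "\<lambda>v. \<nu> v * exp_mult m l v * ?x v"
  \<comment> \<open>The quotients lie above \<open>?w\<close> and below the quotient with step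
    \<open>s\<close>; \<open>?W\<close> adds integrable bounds for the absolute values of
    both.\<close>
  let ?W = "\<lambda>v. \<bar>?w v\<bar> + (\<nu> v * exp_mult m (l + s *\<^sub>R d) v + \<nu> v * exp_mult m l v) / s"
  have u_eq: "?u n v = \<nu> v * exp_mult m l v * ((exp (t n * ?x v) - 1) / t n)" for n v
    by (simp add: exp_mult_add_scaleR algebra_simps diff_divide_distrib)
  have W: "integrable lebesgue ?W"
    using inner_moment_integrable[OF M, of d] partition_function_integrable[OF l]
      partition_function_integrable[OF dom[OF s order_refl]]
    by simp
  have bound: "norm (?u n v) \<le> ?W v" for n v
  proof -
    let ?p = "\<nu> v * exp_mult m l v"
    have p: "0 < ?p"
      by (simp add: \<nu>_pos exp_mult_pos)
    have "?w v \<le> ?u n v"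
      unfolding u_eq using p exp_quotient_lower[OF t(1)] by (intro mult_left_mono) auto
    moreover have "?u n v \<le> ?p * ((exp (s * ?x v) - 1) / s)"
      unfolding u_eq using p exp_quotient_mono[OF t(1) t(2)] by (intro mult_left_mono) auto
    moreover have "?p * ((exp (s * ?x v) - 1) / s) \<le> (?p * exp (s * ?x v) + ?p) / s"
      using p s by (simp add: field_simps)
    moreover have "0 \<le> (?p * exp (s * ?x v) + ?p) / s"
      using p s by simp
    ultimately show ?thesis
      by (simp add: exp_mult_add_scaleR mult.assoc)
  qed
  have lim: "(\<lambda>n. integral\<^sup>L lebesgue (?u n)) \<longlonglongrightarrow> integral\<^sup>L lebesgue ?w"
  proof (rule integral_dominated_convergence[OF _ _ W])
    show "AE v in lebesgue. (\<lambda>n. ?u n v) \<longlonglongrightarrow> ?w v"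
      unfolding u_eq using t(1) t_lim
      by (intro AE_I2 tendsto_intros exp_quotient_tendsto) (auto simp: less_imp_neq[symmetric])
  qed (use bound in auto)
  have "d \<bullet> moments_of f \<le> integral\<^sup>L lebesgue (?u n)" for n
  proof -
    have "d \<bullet> moments_of f \<le> (partition_function (l + t n *\<^sub>R d) - partition_function l) / t n"
      using min[OF dom[OF t, of n]] t(1)[of n]
      by (simp add: dual_def inner_add_left pos_le_divide_eq algebra_simps)
    also have "\<dots> = integral\<^sup>L lebesgue (?u n)"
      using partition_function_integrable[OF l] partition_function_integrable[OF dom[OF t, of n]]
      by (simp add: partition_function_def)
    finally show ?thesis .
  qed
  then have "d \<bullet> moments_of f \<le> integral\<^sup>L lebesgue ?w"
    by (intro LIMSEQ_le_const[OF lim]) blast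
  then show ?thesis
    by (simp add: integral_inner_moment[OF M])
qed

lemma exists_exp_mult_chi:
  obtains l where "exp_mult m l \<in> chi_set m \<nu> f"
proof -
  obtain l where l: "snd (snd l) < 0" and min: "\<And>l'. snd (snd l') < 0 \<Longrightarrow> dual l \<le> dual l'"
    using dual_has_minimiser by blast
  let ?e = "moments_of (exp_mult m l) - moments_of f"
  \<comment> \<open>Steepest descent: \<open>?e\<close> is the gradient of the dual at
    \<open>l\<close>, and the direction \<open>- ?e\<close> forces its squared norm to be
    nonpositive.\<close>
  have "(- ?e) \<bullet> moments_of f \<le> (- ?e) \<bullet> moments_of (exp_mult m l)"
    by (rule dual_minimiser_inner_le[OF l min])
  then have "?e \<bullet> ?e \<le> 0"
    by (simp add: inner_diff_left inner_diff_right)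
  then have "moments_of (exp_mult m l) = moments_of f"
    by (metis eq_iff_diff_eq_0 inner_eq_zero_iff inner_ge_zero order_antisym)
  then have "exp_mult m l \<in> chi_set m \<nu> f"
    using l by (simp add: chi_set_iff exp_mult_integrable_iff exp_mult_pos less_imp_le)
  then show thesis
    by (rule that)
qed

lemma exists_unique_multiplier: "\<exists>!l. solves_min m \<nu> f (exp_mult m l)"
proof -
  obtain l where "exp_mult m l \<in> chi_set m \<nu> f"
    by (rule exists_exp_mult_chi)
  then show ?thesis
    using exp_mult_solves_min exp_mult_chi_unique by (metis solves_min_def)
qed

end

section \<open>The result in coordinates\<close>

theorem corollary3p5:
  fixes m :: "nat \<Rightarrow> real"
    and \<nu> :: "nat \<Rightarrow> nat \<Rightarrow> real ^ 3 \<Rightarrow> real"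
    and f :: "nat \<Rightarrow> real ^ 3 \<Rightarrow> real"
    and k :: nat
  assumes "k \<in> {1, 2}"
    and "m k > 0"
    and "\<nu> k k \<in> borel_measurable lebesgue"
    and "\<forall>v. \<nu> k k v > 0"
    and "{l. exp_mult (m k) l \<in> D_set (\<nu> k k)} = {l. integrable lebesgue (exp_mult (m k) l)}"
    and "{l. integrable lebesgue (exp_mult (m k) l)} = {(l0, l1, l2). l2 < 0}"
    and "f k \<in> D_set (\<nu> k k)"
  shows "\<exists>!l :: real \<times> (real ^ 3) \<times> real. case l of (l0, l1, l2) \<Rightarrow>
           solves_min (m k) (\<nu> k k) (f k)
             (\<lambda>v. exp (m k * l0 + m k * (l1 \<bullet> v) + m k * l2 * (norm v)\<^sup>2))"
proof -
  let ?\<nu> = "\<nu> k k"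
  have D: "exp_mult (m k) l \<in> D_set ?\<nu> \<longleftrightarrow> snd (snd l) < 0" for l
    using assms(5,6) by (cases l) (simp add: set_eq_iff)
  interpret moment_problem "m k" ?\<nu> "f k"
  proof
    \<comment> \<open>For an exponential, membership in \<open>D_set\<close> reduces to weighted
      integrability: it is positive everywhere, and the whole space is not a null set.\<close>
    show "integrable lebesgue (\<lambda>v. ?\<nu> v * (1 + (norm v)\<^sup>2) * exp_mult (m k) l v) \<longleftrightarrow> snd (snd l) < 0" for l
      unfolding D[symmetric] D_set_def
      by (simp add: exp_mult_pos less_imp_le less_imp_neq[OF exp_mult_pos, symmetric] not_AE_lebesgue_False)
  qed (use assms in auto)
  have "(case l of (l0, l1, l2) \<Rightarrow> solves_min (m k) ?\<nu> (f k)
      (\<lambda>v. exp (m k * l0 + m k * (l1 \<bullet> v) + m k * l2 * (norm v)\<^sup>2)))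
    \<longleftrightarrow> solves_min (m k) ?\<nu> (f k) (exp_mult (m k) l)" for l
    by (cases l) (simp add: exp_mult_def [abs_def] moment_vec_def algebra_simps)
  then show ?thesis
    using exists_unique_multiplier by simp
qed

end
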